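(* Let $S\subset\mathbb{Z}^d$ be a pointed affine semigroup generated by $\mathcal{A}=\{a_1,\ldots,a_n\}$, let $w\in\mathbb{N}^n$ and let $S_w=\mathbb{N}\mathcal{A}_w$. Then, for each $b\in\operatorname{Betti}(S)$ there exists $\lambda\in\mathbb{N}$ such that $(b,\lambda)\in\operatorname{Betti}(S_w)$.
   Context: $\mathbb{N}$ contains $0$. An affine semigroup is a finitely generated submonoid $S$ of $\mathbb{Z}^d$ such that the group generated by $S$ is $\mathbb{Z}^d$; it is pointed if $S\cap(-S)=\{0\}$. For $\mathcal{A}=\{a_1,\ldots,a_n\}$ and $w=(w_1,\ldots,w_n)\in\mathbb{N}^n$, $\mathcal{A}_w:=\{(a_1,w_1),\ldots,(a_n,w_n),(0,\ldots,0,1)\}\subset\mathbb{Z}^{d+1}$, and $\mathbb{N}\mathcal{A}_w$ is the submonoid it generates. Betti elements: let $\pi_{\mathcal{A}}:\mathbb{N}^n\to\mathbb{Z}^d$, $u\mapsto u_1a_1+\cdots+u_na_n$, and let $\sim_{\mathcal{A}}$ be its kernel congruence ($\alpha\sim_{\mathcal{A}}\beta$ iff $\pi_{\mathcal{A}}(\alpha)=\pi_{\mathcal{A}}(\beta)$). A presentation of $S=\mathbb{N}\mathcal{A}$ is a set $\rho\subset\mathbb{N}^n\times\mathbb{N}^n$ generating the congruence $\sim_{\mathcal{A}}$; it is minimal if it is a minimal system of generators (equivalently, the binomials $x^\alpha-x^\beta$, $(\alpha,\beta)\in\rho$, form a minimal set of binomial generators of the toric ideal $I_{\mathcal{A}}=\langle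 x^u-x^v\mid\pi_{\mathcal{A}}(u)=\pi_{\mathcal{A}}(v)\rangle$). Then $\operatorname{Betti}(S):=\{\pi_{\mathcal{A}}(\alpha)\mid(\alpha,\beta)\in\rho\}$ for any minimal presentation $\rho$; this set does not depend on $\rho$. $\operatorname{Betti}(S_w)$ is defined in the same way using the generators $\mathcal{A}_w$. *)

theory Defs
  imports "HOL-Analysis.Analysis" "HOL-Computational_Algebra.Group_Closure"
begin

definition add_submonoid :: "'a::comm_monoid_add set \<Rightarrow> bool" where
  "add_submonoid M \<longleftrightarrow> 0 \<in> M \<and> (\<forall>x\<in>M. \<forall>y\<in>M. x + y \<in> M)"

definition affine_semigroup :: "(int ^ 'd) set \<Rightarrow> bool" where
  "affine_semigroup S \<longleftrightarrow>
     (\<exists>A. finite A \<and> S = add_submonoid hull A) \<and> group_closure S = UNIV"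

definition pointed :: "'a::ab_group_add set \<Rightarrow> bool" where
  "pointed S \<longleftrightarrow> S \<inter> uminus ` S = {0}"

definition add_congruence :: "('a::comm_monoid_add \<times> 'a) set \<Rightarrow> bool" where
  "add_congruence r \<longleftrightarrow> equiv UNIV r \<and> (\<forall>x y z. (x, y) \<in> r \<longrightarrow> (x + z, y + z) \<in> r)"

definition factor_map :: "('n::finite \<Rightarrow> int ^ 'd) \<Rightarrow> nat ^ 'n \<Rightarrow> int ^ 'd" where
  "factor_map a u = (\<Sum>i\<in>UNIV. int (u $ i) *s a i)"

definition kernel_congruence :: "('n::finite \<Rightarrow> int ^ 'd) \<Rightarrow> ((nat ^ 'n) \<times> (nat ^ 'n)) set" where
  "kernel_congruence a = {(\<alpha>, \<beta>). factor_map a \<alpha> = factor_map a \<beta>}"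

definition presentation ::
  "('n::finite \<Rightarrow> int ^ 'd) \<Rightarrow> ((nat ^ 'n) \<times> (nat ^ 'n)) set \<Rightarrow> bool" where
  "presentation a \<rho> \<longleftrightarrow> add_congruence hull \<rho> = kernel_congruence a"

definition minimal_presentation ::
  "('n::finite \<Rightarrow> int ^ 'd) \<Rightarrow> ((nat ^ 'n) \<times> (nat ^ 'n)) set \<Rightarrow> bool" where
  "minimal_presentation a \<rho> \<longleftrightarrow> presentation a \<rho> \<and> (\<forall>\<sigma>. \<sigma> \<subset> \<rho> \<longrightarrow> \<not> presentation a \<sigma>)"

text \<open>
  For a pointed semigroup all minimal presentations have the same set of degrees, so the
  union over all of them is the set obtained from any single one.
\<close>

definition Betti :: "('n::finite \<Rightarrow> int ^ 'd) \<Rightarrow> (int ^ 'd) set" where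
  "Betti a = {factor_map a \<alpha> | \<alpha> \<beta> \<rho>. minimal_presentation a \<rho> \<and> (\<alpha>, \<beta>) \<in> \<rho>}"

text \<open>
  \<open>\<int>\<^sup>d\<^sup>+\<^sup>1\<close> is \<open>int ^ ('d option)\<close>, with \<open>None\<close> the index of the last coordinate; likewise
  \<open>None\<close> indexes the additional generator of the extended family.
\<close>

definition append_coord :: "int ^ 'd \<Rightarrow> int \<Rightarrow> int ^ ('d option)" where
  "append_coord v c = (\<chi> k. case k of None \<Rightarrow> c | Some j \<Rightarrow> v $ j)"

definition weighted_extension ::
  "('n::finite \<Rightarrow> int ^ 'd) \<Rightarrow> nat ^ 'n \<Rightarrow> 'n option \<Rightarrow> int ^ ('d option)" where
  "weighted_extension a w k =
     (case k of None \<Rightarrow> append_coord 0 1 | Some i \<Rightarrow> append_coord (a i) (int (w $ i)))"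

end

theory Submission
  imports Defs
begin

text \<open>
  Forgetting the last coordinate turns a presentation of \<open>S\<^sub>w\<close> into a presentation of \<open>S\<close>, since
  powers of the additional generator level out the weights of two factorizations of the same
  element. A derivation between factorizations of \<open>b\<close> only uses relations whose degree
  divides \<open>b\<close>. If some presentation of \<open>S\<close> avoids the degree \<open>b\<close>, then, \<open>S\<close> being pointed, all
  relations of degree \<open>b\<close> follow from relations of strictly smaller degrees, so a minimal
  presentation of \<open>S\<close> avoids the degree \<open>b\<close> as well. Minimal presentations of \<open>S\<^sub>w\<close> exist by
  Dickson's lemma.
\<close>

section \<open>Additive congruences and the congruence generated by a set of pairs\<close>

lemma add_congruenceI:
  assumes "\<And>x. (x, x) \<in> r"
    and "\<And>x y. (x, y) \<in> r \<Longrightarrow> (y, x) \<in> r"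
    and "\<And>x y z. (x, y) \<in> r \<Longrightarrow> (y, z) \<in> r \<Longrightarrow> (x, z) \<in> r"
    and "\<And>x y z. (x, y) \<in> r \<Longrightarrow> (x + z, y + z) \<in> r"
  shows "add_congruence r"
proof -
  have "refl r" by (rule refl_onI) (rule assms(1))
  moreover have "sym r" by (rule symI) (rule assms(2))
  moreover have "trans r" by (rule transI) (rule assms(3))
  ultimately show ?thesis
    using assms(4) by (simp add: add_congruence_def equiv_def)
qed

lemma
  assumes "add_congruence r"
  shows add_congruence_refl: "(x, x) \<in> r"
    and add_congruence_sym: "(x, y) \<in> r \<Longrightarrow> (y, x) \<in> r"
    and add_congruence_trans: "(x, y) \<in> r \<Longrightarrow> (y, z) \<in> r \<Longrightarrow> (x, z) \<in> r"
    and add_congruence_add_right: "(x, y) \<in> r \<Longrightarrow> (x + z, y + z) \<in> r"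
proof -
  have eq: "refl r" "sym r" "trans r"
    using assms by (simp_all add: add_congruence_def equiv_def)
  show "(x, x) \<in> r"
    using eq(1) by (simp add: refl_on_def)
  show "(x, y) \<in> r \<Longrightarrow> (y, x) \<in> r"
    by (rule symD[OF eq(2)])
  show "(x, y) \<in> r \<Longrightarrow> (y, z) \<in> r \<Longrightarrow> (x, z) \<in> r"
    by (rule transD[OF eq(3)])
  show "(x, y) \<in> r \<Longrightarrow> (x + z, y + z) \<in> r"
    using assms by (simp add: add_congruence_def)
qed

lemma add_congruence_add:
  assumes "add_congruence r" "(x, y) \<in> r" "(x', y') \<in> r"
  shows "(x + x', y + y') \<in> r"
proof -
  have "(x' + y, y' + y) \<in> r"
    by (rule add_congruence_add_right[OF assms(1,3)])
  then show ?thesis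
    using add_congruence_add_right[OF assms(1,2), of x'] add_congruence_trans[OF assms(1)]
    by (simp add: add.commute)
qed

text \<open>All closure conditions survive arbitrary intersections, so the hull is the generated
  congruence itself and not merely an intersection containing the pairs.\<close>

lemma add_congruence_hull: "add_congruence (add_congruence hull \<rho>)"
proof (rule hull_in)
  fix T :: "('a \<times> 'a) set set"
  assume T: "Ball T add_congruence"
  have cong: "add_congruence r" if "r \<in> T" for r
    using T that by blast
  show "add_congruence (\<Inter>T)"
  proof (rule add_congruenceI; rule InterI)
    show "(x, x) \<in> r" if "r \<in> T" for x r
      by (rule add_congruence_refl[OF cong[OF that]])
    show "(y, x) \<in> r" if "(x, y) \<in> \<Inter>T" "r \<in> T" for x y r
      using add_congruence_sym[OF cong] that by simp
    show "(x, z) \<in> r" if "(x, y) \<in> \<Inter>T" "(y, z) \<in> \<Inter>T" "r \<in> T" for x y z r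
      using add_congruence_trans[OF cong[OF that(3)], of x y z] that by simp
    show "(x + z, y + z) \<in> r" if "(x, y) \<in> \<Inter>T" "r \<in> T" for x y z r
      using add_congruence_add_right[OF cong] that by simp
  qed
qed

section \<open>Degrees of factorizations and the semigroup they form\<close>

lemma factor_map_add: "factor_map a (u + v) = factor_map a u + factor_map a v"
proof -
  have "int ((u + v) $ i) *s a i = int (u $ i) *s a i + int (v $ i) *s a i" for i
    by (simp only: vector_add_component of_nat_add vector_sadd_rdistrib)
  then show ?thesis
    by (simp only: factor_map_def sum.distrib)
qed

lemma factor_map_0 [simp]: "factor_map a 0 = 0"
  by (simp add: factor_map_def)

lemma factor_map_eqI:
  "(u, v) \<in> kernel_congruence a \<Longrightarrow> factor_map a u = factor_map a v"
  by (simp add: kernel_congruence_def)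

lemma add_congruence_kernel: "add_congruence (kernel_congruence a)"
  by (rule add_congruenceI) (simp_all add: kernel_congruence_def factor_map_add)

lemma factor_map_in_submonoid:
  assumes "add_submonoid M" "range a \<subseteq> M"
  shows "factor_map a u \<in> M"
proof -
  have mult: "int k *s a i \<in> M" for k i
  proof (induction k)
    case 0
    then show ?case using assms by (simp add: add_submonoid_def)
  next
    case (Suc k)
    have "int (Suc k) *s a i = a i + int k *s a i"
      by (simp only: of_nat_Suc vector_sadd_rdistrib vector_smult_lid)
    then show ?case
      using assms Suc by (auto simp: add_submonoid_def)
  qed
  have "(\<Sum>i\<in>F. int (u $ i) *s a i) \<in> M" if "finite F" for F
    using that
  proof (induction F)
    case empty
    then show ?case using assms by (simp add: add_submonoid_def)
  next
    case (insert i F)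
    then show ?case using assms mult by (simp add: add_submonoid_def)
  qed
  then show ?thesis by (simp add: factor_map_def)
qed

lemma factor_map_in_hull: "factor_map a u \<in> add_submonoid hull (range a)"
  unfolding hull_def using factor_map_in_submonoid by blast

text \<open>Both degrees lie in the semigroup and are negatives of each other. This is how
  pointedness enters: it makes divisibility between degrees antisymmetric.\<close>

lemma pointed_factor_map_eq_0:
  assumes "pointed (add_submonoid hull (range a))" "factor_map a u + factor_map a v = 0"
  shows "factor_map a u = 0"
proof -
  have "factor_map a u = - factor_map a v"
    using assms(2) by (simp add: eq_neg_iff_add_eq_0)
  then show ?thesis
    using assms(1) factor_map_in_hull[of a u] factor_map_in_hull[of a v]
    unfolding pointed_def by blast
qed

section \<open>Which degrees a presentation must contain\<close>

text \<open>The pairs derivable from relations whose degree divides their own degree already form a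
  congruence containing \<open>\<rho>\<close>, so they exhaust the hull.\<close>

lemma hull_degree_local:
  assumes "\<rho> \<subseteq> kernel_congruence a" "(u, v) \<in> add_congruence hull \<rho>"
  shows "(u, v) \<in> add_congruence hull
    {p \<in> \<rho>. \<exists>z. factor_map a u = factor_map a (fst p) + factor_map a z}"
proof -
  define L where "L x = {p \<in> \<rho>. \<exists>z. x = factor_map a (fst p) + factor_map a z}" for x
  \<comment> \<open>Membership in the kernel is part of \<open>r\<close> so that both components
    have the same degree; symmetry and transitivity then refer to one and the same set
    \<open>L\<close>.\<close>
  define r where
    "r = {(u, v). (u, v) \<in> kernel_congruence a \<and> (u, v) \<in> add_congruence hull (L (factor_map a u))}"
  \<comment> \<open>Translating a pair by \<open>y\<close> multiplies its degree in the semigroup,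
    and divisors of the old degree still divide the new one.\<close>
  have mono: "L x \<subseteq> L (x + factor_map a y)" for x y
    unfolding L_def by (auto simp: add.assoc simp flip: factor_map_add)
  have "add_congruence r"
  proof (rule add_congruenceI)
    show "(x, x) \<in> r" for x
      by (simp add: r_def kernel_congruence_def add_congruence_refl[OF add_congruence_hull])
    show "(y, x) \<in> r" if "(x, y) \<in> r" for x y
      using that add_congruence_sym[OF add_congruence_hull]
      by (auto simp: r_def kernel_congruence_def)
    show "(x, z) \<in> r" if "(x, y) \<in> r" "(y, z) \<in> r" for x y z
      using that add_congruence_trans[OF add_congruence_hull]
      by (auto simp: r_def kernel_congruence_def)
    show "(x + z, y + z) \<in> r" if "(x, y) \<in> r" for x y z
    proof -
      have "(x + z, y + z) \<in> add_congruence hull (L (factor_map a x))"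
        using that add_congruence_add_right[OF add_congruence_hull] by (auto simp: r_def)
      then have "(x + z, y + z) \<in> add_congruence hull (L (factor_map a x + factor_map a z))"
        using hull_mono[OF mono] by blast
      then show ?thesis
        using that by (simp add: r_def kernel_congruence_def factor_map_add)
    qed
  qed
  moreover have "\<rho> \<subseteq> r"
  proof
    fix p assume p: "p \<in> \<rho>"
    have "factor_map a (fst p) = factor_map a (fst p) + factor_map a 0"
      by simp
    then have "p \<in> L (factor_map a (fst p))"
      using p unfolding L_def by blast
    then show "p \<in> r"
      using p assms(1) hull_subset[of "L (factor_map a (fst p))" add_congruence]
      by (auto simp: r_def)
  qed
  ultimately have "add_congruence hull \<rho> \<subseteq> r"
    by (intro hull_minimal)
  then show ?thesis
    using assms(2) by (auto simp: r_def L_def)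
qed

lemma presentation_subset_kernel: "presentation a \<rho> \<Longrightarrow> \<rho> \<subseteq> kernel_congruence a"
  unfolding presentation_def using hull_subset by metis

text \<open>If \<open>\<sigma>\<close> avoided the degree of \<open>\<alpha>\<close>, then deleting
  from \<open>\<rho>\<close> every relation of that degree would leave a presentation. Applied to
  two minimal presentations, this shows that their degrees agree.\<close>

lemma minimal_presentation_degree:
  assumes pointed: "pointed (add_submonoid hull (range a))"
    and min: "minimal_presentation a \<rho>" and mem: "(\<alpha>, \<beta>) \<in> \<rho>"
    and \<sigma>: "presentation a \<sigma>"
  shows "\<exists>p\<in>\<sigma>. factor_map a (fst p) = factor_map a \<alpha>"
proof (rule ccontr)
  assume "\<not> ?thesis"
  then have avoid: "factor_map a (fst p) \<noteq> factor_map a \<alpha>" if "p \<in> \<sigma>" for p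
    using that by blast
  define \<rho>' where "\<rho>' = {p \<in> \<rho>. factor_map a (fst p) \<noteq> factor_map a \<alpha>}"
  let ?H = "add_congruence hull \<rho>'"
  have \<rho>: "presentation a \<rho>"
    using min by (simp add: minimal_presentation_def)
  \<comment> \<open>When the degree of \<open>\<alpha>\<close> does not divide that of
    \<open>u\<close>, a local derivation from \<open>\<rho>\<close> cannot use any deleted
    relation.\<close>
  have lower: "(u, v) \<in> ?H"
    if "(u, v) \<in> kernel_congruence a" "\<nexists>z. factor_map a u = factor_map a \<alpha> + factor_map a z"
    for u v
  proof -
    have "(u, v) \<in> add_congruence hull
        {p \<in> \<rho>. \<exists>z. factor_map a u = factor_map a (fst p) + factor_map a z}"
      using \<rho> that(1) presentation_subset_kernel[OF \<rho>]
      by (intro hull_degree_local) (auto simp: presentation_def)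
    moreover have "{p \<in> \<rho>. \<exists>z. factor_map a u = factor_map a (fst p) + factor_map a z} \<subseteq> \<rho>'"
      using that(2) by (auto simp: \<rho>'_def)
    ultimately show ?thesis
      using hull_mono by blast
  qed
  \<comment> \<open>Here \<open>\<sigma>\<close> replaces \<open>\<rho>\<close>: the relations of
    \<open>\<sigma>\<close> in a local derivation have degrees that properly divide that of
    \<open>\<alpha>\<close>. By pointedness the degree of \<open>\<alpha>\<close> does not divide
    theirs, so \<open>lower\<close> covers them.\<close>
  have same: "(u, v) \<in> ?H"
    if uv: "(u, v) \<in> kernel_congruence a" "factor_map a u = factor_map a \<alpha>" for u v
  proof -
    let ?L = "{p \<in> \<sigma>. \<exists>z. factor_map a u = factor_map a (fst p) + factor_map a z}"
    have "(u, v) \<in> add_congruence hull ?L"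
      using \<sigma> uv(1) presentation_subset_kernel[OF \<sigma>]
      by (intro hull_degree_local) (auto simp: presentation_def)
    moreover have "?L \<subseteq> ?H"
    proof
      fix p assume p: "p \<in> ?L"
      then obtain z where z: "factor_map a \<alpha> = factor_map a (fst p) + factor_map a z"
        using uv(2) by auto
      have "\<nexists>z'. factor_map a (fst p) = factor_map a \<alpha> + factor_map a z'"
      proof
        assume "\<exists>z'. factor_map a (fst p) = factor_map a \<alpha> + factor_map a z'"
        then obtain z' where "factor_map a (fst p) = factor_map a \<alpha> + factor_map a z'"
          by blast
        with z have "factor_map a z + factor_map a z' = 0"
          by (simp add: algebra_simps)
        then have "factor_map a z = 0"
          by (rule pointed_factor_map_eq_0[OF pointed])
        then show False
          using z avoid[of p] p by simp
      qed
      then show "p \<in> ?H"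
        using lower[of "fst p" "snd p"] p presentation_subset_kernel[OF \<sigma>] by auto
    qed
    ultimately show ?thesis
      using hull_minimal[of ?L ?H add_congruence] add_congruence_hull[of \<rho>'] by blast
  qed
  have "\<rho> \<subseteq> ?H"
  proof
    fix p assume p: "p \<in> \<rho>"
    show "p \<in> ?H"
    proof (cases "factor_map a (fst p) = factor_map a \<alpha>")
      case True
      then show ?thesis
        using same[of "fst p" "snd p"] p presentation_subset_kernel[OF \<rho>] by auto
    next
      case False
      then show ?thesis
        using p hull_subset[of \<rho>' add_congruence] by (auto simp: \<rho>'_def)
    qed
  qed
  then have "add_congruence hull \<rho> \<subseteq> ?H"
    by (intro hull_minimal add_congruence_hull)
  moreover have "?H \<subseteq> add_congruence hull \<rho>"
    by (intro hull_mono) (auto simp: \<rho>'_def)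
  ultimately have "presentation a \<rho>'"
    using \<rho> by (simp add: presentation_def)
  moreover have "(\<alpha>, \<beta>) \<notin> \<rho>'" "\<rho>' \<subseteq> \<rho>"
    by (auto simp: \<rho>'_def)
  then have "\<rho>' \<subset> \<rho>"
    using mem by blast
  ultimately show False
    using min by (simp add: minimal_presentation_def)
qed

section \<open>Dickson's lemma and the existence of minimal presentations\<close>

lemma nat_seq_mono_subseq:
  fixes f :: "nat \<Rightarrow> nat"
  obtains r :: "nat \<Rightarrow> nat" where "strict_mono r" "mono (\<lambda>k. f (r k))"
proof -
  obtain g where g: "strict_mono g" "monoseq (\<lambda>k. f (g k))"
    using seq_monosub by blast
  from g(2) consider "mono (\<lambda>k. f (g k))" | "antimono (\<lambda>k. f (g k))"
    unfolding monoseq_def by (auto intro: monoI antimonoI)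
  then show thesis
  proof cases
    case 1
    then show ?thesis using g(1) that by blast
  next
    case 2
    \<comment> \<open>An antitone sequence of naturals is constant once it reaches its least value;
      the tail from there on is the required subsequence.\<close>
    define m where "m = (LEAST x. x \<in> range (\<lambda>k. f (g k)))"
    have "m \<in> range (\<lambda>k. f (g k))"
      unfolding m_def by (rule LeastI) (rule rangeI)
    then obtain N where N: "m = f (g N)" by auto
    have "f (g (N + k)) = m" for k
    proof (rule antisym)
      show "f (g (N + k)) \<le> m"
        using antimonoD[OF 2, of N "N + k"] N by simp
      show "m \<le> f (g (N + k))"
        unfolding m_def by (rule Least_le) (rule rangeI)
    qed
    then have "mono (\<lambda>k. f (g (N + k)))"
      by (simp add: mono_def)
    moreover have "strict_mono (\<lambda>k. g (N + k))"
      using g(1) by (simp add: strict_mono_def)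
    ultimately show ?thesis by (rule that[rotated])
  qed
qed

text \<open>Subsequences are refined once per function, and refinement keeps the monotonicity
  already obtained. Arbitrary functions instead of coordinates let it apply directly to pairs of
  vectors.\<close>

lemma Dickson_subseq:
  fixes x :: "nat \<Rightarrow> 'a" and \<Phi> :: "('a \<Rightarrow> nat) set"
  assumes "finite \<Phi>"
  shows "\<exists>r :: nat \<Rightarrow> nat. strict_mono r \<and> (\<forall>\<phi>\<in>\<Phi>. mono (\<lambda>k. \<phi> (x (r k))))"
  using assms
proof (induction \<Phi>)
  case empty
  then show ?case by (auto intro: strict_mono_id)
next
  case (insert \<phi> \<Phi>)
  then obtain r :: "nat \<Rightarrow> nat" where r: "strict_mono r" "\<forall>\<psi>\<in>\<Phi>. mono (\<lambda>k. \<psi> (x (r k)))"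
    by blast
  obtain s :: "nat \<Rightarrow> nat" where s: "strict_mono s" "mono (\<lambda>k. \<phi> (x (r (s k))))"
    using nat_seq_mono_subseq[of "\<lambda>k. \<phi> (x (r k))"] by blast
  have "strict_mono (\<lambda>k. r (s k))"
    using r(1) s(1) by (simp add: strict_mono_def)
  moreover have "mono (\<lambda>k. \<psi> (x (r (s k))))" if "\<psi> \<in> \<Phi>" for \<psi>
    using that r(2) strict_mono_mono[OF s(1)] by (simp add: mono_def)
  ultimately show ?case
    using s(2) by (intro exI[of _ "\<lambda>k. r (s k)"]) auto
qed

text \<open>
  The generators are the minimal nonzero pairs: the kernel is closed under differences, hence
  every pair in it is a sum of minimal ones.
\<close>

lemma finite_presentation_exists:
  fixes a :: "'n::finite \<Rightarrow> int ^ 'd"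
  shows "\<exists>\<rho>. finite \<rho> \<and> presentation a \<rho>"
proof -
  define K where "K = kernel_congruence a"
  define \<Phi> :: "((nat ^ 'n) \<times> (nat ^ 'n) \<Rightarrow> nat) set"
    where "\<Phi> = range (\<lambda>i p. fst p $ i) \<union> range (\<lambda>i p. snd p $ i)"
  define le where "le p q \<longleftrightarrow> (\<forall>\<phi>\<in>\<Phi>. \<phi> p \<le> \<phi> q)" for p q
  define size where "size p = (\<Sum>i\<in>UNIV. fst p $ i + snd p $ i)"
    for p :: "(nat ^ 'n) \<times> (nat ^ 'n)"
  \<comment> \<open>Minimality for \<open>le\<close> is measured by total size: by
    \<open>split\<close> and \<open>size_add\<close>, a pair below \<open>p\<close> of at least the
    same size equals \<open>p\<close>.\<close>
  define M where "M = {p \<in> K. p \<noteq> 0 \<and> (\<forall>q\<in>K. q \<noteq> 0 \<longrightarrow> le q p \<longrightarrow> size p \<le> size q)}"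
  have le_iff: "le p q \<longleftrightarrow> (\<forall>i. fst p $ i \<le> fst q $ i \<and> snd p $ i \<le> snd q $ i)" for p q
    by (auto simp: le_def \<Phi>_def)
  \<comment> \<open>Subtraction of naturals truncates, so \<open>le q p\<close> is what makes it a
    true inverse of addition.\<close>
  have split: "p = q + (p - q)" if "le q p" for p q
    using that by (auto simp: le_iff prod_eq_iff vec_eq_iff)
  have size_add: "size (p + q) = size p + size q" for p q
    by (simp add: size_def sum.distrib algebra_simps)
  have size_0: "p = 0" if "size p = 0" for p
    using that by (auto simp: size_def prod_eq_iff vec_eq_iff)
  have K_diff: "p - q \<in> K" if "p \<in> K" "q \<in> K" "le q p" for p q
  proof -
    have "factor_map a (fst p) = factor_map a (fst q) + factor_map a (fst (p - q))"
      "factor_map a (snd p) = factor_map a (snd q) + factor_map a (snd (p - q))"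
      using split[OF that(3)] by (metis factor_map_add fst_add, metis factor_map_add snd_add)
    then show ?thesis
      using that(1,2) by (auto simp: K_def kernel_congruence_def case_prod_beta)
  qed
  have "finite M"
  proof (rule ccontr)
    assume "infinite M"
    then obtain x :: "nat \<Rightarrow> _" where x: "inj x" "range x \<subseteq> M"
      using infinite_countable_subset by blast
    have "finite \<Phi>" by (simp add: \<Phi>_def)
    then obtain r :: "nat \<Rightarrow> nat" where r: "strict_mono r" "\<forall>\<phi>\<in>\<Phi>. mono (\<lambda>k. \<phi> (x (r k)))"
      using Dickson_subseq by blast
    \<comment> \<open>Two distinct members of \<open>M\<close> that are comparable contradict
      minimality of the larger one.\<close>
    define p q where "p = x (r 0)" and "q = x (r 1)"
    have le: "le p q"
      using r(2) by (auto simp: le_def p_def q_def mono_def)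
    have "p \<in> M" "q \<in> M"
      using x(2) by (auto simp: p_def q_def)
    then have "size q \<le> size p"
      using le by (auto simp: M_def)
    then have "q - p = 0"
      using size_add[of p "q - p"] split[OF le] by (intro size_0) simp
    then have "p = q"
      using split[OF le] by simp
    moreover have "r 0 \<noteq> r 1"
      using strict_monoD[OF r(1), of 0 1] by simp
    ultimately show False
      using x(1) by (auto simp: p_def q_def inj_def)
  qed
  moreover have "K \<subseteq> add_congruence hull M"
  proof
    fix p assume "p \<in> K"
    then show "p \<in> add_congruence hull M"
    proof (induction "size p" arbitrary: p rule: less_induct)
      case less
      show ?case
      proof (cases "p = 0")
        case True
        then show ?thesis
          using add_congruence_refl[OF add_congruence_hull] by (simp add: zero_prod_def)
      next
        case False
        define C where "C q \<longleftrightarrow> q \<in> K \<and> q \<noteq> 0 \<and> le q p" for q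
        have "C p"
          using less.prems False by (simp add: C_def le_iff)
        \<comment> \<open>A nonzero kernel pair of least size below \<open>p\<close> is minimal
          overall, since anything below \<open>q\<close> is also below \<open>p\<close>.\<close>
        then obtain q where q: "C q" "\<And>q'. C q' \<Longrightarrow> size q \<le> size q'"
          using ex_has_least_nat[of C p size] by blast
        have "q \<in> M"
          unfolding M_def
        proof (intro CollectI conjI ballI impI)
          show "q \<in> K" "q \<noteq> 0" using q(1) by (auto simp: C_def)
          fix q' assume "q' \<in> K" "q' \<noteq> 0" "le q' q"
          then have "C q'"
            using q(1) by (auto simp: C_def le_iff intro: order_trans)
          then show "size q \<le> size q'" by (rule q(2))
        qed
        then have "q \<in> add_congruence hull M"
          by (rule hull_inc)
        moreover have "p - q \<in> add_congruence hull M"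
        proof (rule less.hyps)
          show "p - q \<in> K"
            using K_diff less.prems q(1) by (auto simp: C_def)
          have "size q \<noteq> 0"
            using q(1) size_0[of q] unfolding C_def by blast
          then show "size (p - q) < size p"
            using size_add[of q "p - q"] split[of q p] q(1) by (simp add: C_def)
        qed
        ultimately have "q + (p - q) \<in> add_congruence hull M"
          using add_congruence_add[OF add_congruence_hull,
              of "fst q" "snd q" M "fst (p - q)" "snd (p - q)"]
          by (simp only: prod.collapse plus_prod_def)
        then show ?thesis
          using split[of q p] q(1) by (simp add: C_def)
      qed
    qed
  qed
  moreover have "add_congruence hull M \<subseteq> K"
    by (rule hull_minimal) (auto simp: M_def K_def intro: add_congruence_kernel)
  ultimately show ?thesis
    unfolding presentation_def K_def by blast
qed

text \<open>A finite presentation has finitely many subsets. One that is inclusion-minimal among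
  those that present is minimal outright, as its own subsets are among them.\<close>

lemma minimal_presentation_exists: "\<exists>\<rho>. minimal_presentation a \<rho>"
proof -
  obtain \<rho> where \<rho>: "finite \<rho>" "presentation a \<rho>"
    using finite_presentation_exists by blast
  let ?P = "{\<sigma> \<in> Pow \<rho>. presentation a \<sigma>}"
  have "finite ?P" "?P \<noteq> {}"
    using \<rho> by auto
  then obtain \<sigma> where "\<sigma> \<in> ?P" "\<forall>\<tau>\<in>?P. \<tau> \<subseteq> \<sigma> \<longrightarrow> \<sigma> = \<tau>"
    using finite_has_minimal[of ?P] by blast
  then have "minimal_presentation a \<sigma>"
    unfolding minimal_presentation_def by blast
  then show ?thesis ..
qed

section \<open>Passing between factorizations in \<open>S_w\<close> and in \<open>S\<close>\<close>

definition forget_last :: "nat ^ ('n option) \<Rightarrow> nat ^ 'n::finite" where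
  "forget_last u = (\<chi> i. u $ Some i)"

lemma forget_last_add: "forget_last (u + v) = forget_last u + forget_last v"
  by (simp add: forget_last_def vec_eq_iff)

lemma append_coord_eq_iff: "append_coord v c = append_coord v' c' \<longleftrightarrow> v = v' \<and> c = c'"
proof
  assume eq: "append_coord v c = append_coord v' c'"
  have "v $ j = v' $ j" for j
    using arg_cong[OF eq, of "\<lambda>x. x $ Some j"] by (simp add: append_coord_def)
  moreover have "c = c'"
    using arg_cong[OF eq, of "\<lambda>x. x $ None"] by (simp add: append_coord_def)
  ultimately show "v = v' \<and> c = c'"
    by (simp add: vec_eq_iff)
qed simp

text \<open>The last coordinate is the weight of the factorization plus the multiplicity of the
  additional generator. Its form as \<open>int\<close> of a natural number supplies the \<lambda> of
  the theorem.\<close>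

lemma factor_map_weighted_extension:
  "factor_map (weighted_extension a w) u =
    append_coord (factor_map a (forget_last u))
      (int ((\<Sum>i\<in>UNIV. u $ Some i * w $ i) + u $ None))"
proof -
  have "factor_map (weighted_extension a w) u $ k =
    append_coord (factor_map a (forget_last u))
      (int ((\<Sum>i\<in>UNIV. u $ Some i * w $ i) + u $ None)) $ k" for k
    by (cases k)
      (simp_all add: factor_map_def UNIV_option_conv sum.reindex weighted_extension_def
        append_coord_def forget_last_def algebra_simps)
  then show ?thesis by (simp add: vec_eq_iff)
qed

lemma presentation_forget_last:
  assumes "presentation (weighted_extension a w) \<sigma>"
  shows "presentation a (map_prod forget_last forget_last ` \<sigma>)" (is "presentation a ?\<tau>")
  unfolding presentation_def
proof (rule antisym)
  have "?\<tau> \<subseteq> kernel_congruence a"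
    using presentation_subset_kernel[OF assms]
    by (auto simp: kernel_congruence_def factor_map_weighted_extension append_coord_eq_iff)
  then show "add_congruence hull ?\<tau> \<subseteq> kernel_congruence a"
    by (intro hull_minimal add_congruence_kernel)
next
  \<comment> \<open>The preimage of the generated congruence under the additive map
    \<open>forget_last\<close> is again a congruence; it contains \<open>\<sigma>\<close>, hence the
    whole kernel for \<open>S_w\<close>.\<close>
  define r where "r = {(u, v). (forget_last u, forget_last v) \<in> add_congruence hull ?\<tau>}"
  have "add_congruence r"
    by (rule add_congruenceI)
      (auto simp: r_def forget_last_add intro: add_congruence_refl[OF add_congruence_hull]
        add_congruence_sym[OF add_congruence_hull] add_congruence_trans[OF add_congruence_hull]
        add_congruence_add_right[OF add_congruence_hull])
  moreover have "\<sigma> \<subseteq> r"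
  proof
    fix p assume "p \<in> \<sigma>"
    then have "map_prod forget_last forget_last p \<in> add_congruence hull ?\<tau>"
      using hull_subset[of ?\<tau> add_congruence] by blast
    then show "p \<in> r"
      by (auto simp: r_def map_prod_def case_prod_beta)
  qed
  ultimately have "add_congruence hull \<sigma> \<subseteq> r"
    by (intro hull_minimal)
  then have ker: "kernel_congruence (weighted_extension a w) \<subseteq> r"
    using assms by (simp add: presentation_def)
  show "kernel_congruence a \<subseteq> add_congruence hull ?\<tau>"
  proof clarify
    fix u v assume uv: "(u, v) \<in> kernel_congruence a"
    define wt where "wt u = (\<Sum>i\<in>UNIV. u $ i * w $ i)" for u :: "nat ^ 'a"
    define lift where "lift u t = (\<chi> k. case k of None \<Rightarrow> t | Some i \<Rightarrow> u $ i)"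
      for u :: "nat ^ 'a" and t :: nat
    have forget: "forget_last (lift u t) = u" for u t
      by (simp add: forget_last_def lift_def vec_eq_iff)
    have "factor_map (weighted_extension a w) (lift u t)
        = append_coord (factor_map a u) (int (wt u + t))" for u t
      by (simp add: factor_map_weighted_extension forget) (simp add: lift_def wt_def)
    \<comment> \<open>Each factorization is padded by the weight of the other, so both last
      coordinates equal \<open>wt u + wt v\<close>.\<close>
    then have "(lift u (wt v), lift v (wt u)) \<in> kernel_congruence (weighted_extension a w)"
      using factor_map_eqI[OF uv] by (simp add: kernel_congruence_def add.commute)
    then show "(u, v) \<in> add_congruence hull ?\<tau>"
      using ker by (auto simp: r_def forget)
  qed
qed

theorem theorem4p4:
  fixes S :: "(int ^ 'd) set"
    and a :: "'n::finite \<Rightarrow> int ^ 'd"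
    and w :: "nat ^ 'n"
  assumes "affine_semigroup S"
    and "pointed S"
    and "S = add_submonoid hull (range a)"
  shows "\<forall>b \<in> Betti a. \<exists>l::nat. append_coord b (int l) \<in> Betti (weighted_extension a w)"
proof
  fix b assume "b \<in> Betti a"
  then obtain \<alpha> \<beta> \<rho> where \<rho>: "minimal_presentation a \<rho>" "(\<alpha>, \<beta>) \<in> \<rho>"
    and b: "b = factor_map a \<alpha>"
    by (auto simp: Betti_def)
  obtain \<sigma> where \<sigma>: "minimal_presentation (weighted_extension a w) \<sigma>"
    using minimal_presentation_exists by blast
  then have "presentation a (map_prod forget_last forget_last ` \<sigma>)"
    by (intro presentation_forget_last[of a w]) (simp add: minimal_presentation_def)
  \<comment> \<open>The projected presentation need not be minimal; it still has a relation of
    degree \<open>b\<close> because the minimal \<open>\<rho>\<close> has one.\<close>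
  then obtain u v where uv: "(u, v) \<in> \<sigma>" "factor_map a (forget_last u) = b"
    using minimal_presentation_degree[OF _ \<rho>] assms(2,3) b by fastforce
  then have "factor_map (weighted_extension a w) u \<in> Betti (weighted_extension a w)"
    using \<sigma> by (auto simp: Betti_def)
  then show "\<exists>l::nat. append_coord b (int l) \<in> Betti (weighted_extension a w)"
    using uv(2) by (auto simp only: factor_map_weighted_extension)
qed

end
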